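(* For every infinite cardinal $\kappa$, the quotient space $\ell^{\infty}_{\kappa^{+}}(\kappa^{++})/\ell^{\infty}_{\kappa}(\kappa^{++})$ is convex-transitive.
   Context: All Banach spaces are real. For infinite cardinals $\lambda\le\mu$, $\ell^\infty(\mu)$ is the space of bounded functions $\mu\to\mathbb{R}$ with the supremum norm, and $\ell^\infty_\lambda(\mu)=\{x\in\ell^\infty(\mu): |\mathrm{supp}(x)|\le\lambda\}$, a closed subspace of $\ell^\infty(\mu)$, where $\mathrm{supp}(x)=\{\alpha: x(\alpha)\ne0\}$. Here $\kappa^+$ is the successor cardinal of $\kappa$ and $\kappa^{++}=(\kappa^+)^+$. The quotient carries the quotient norm. For a Banach space $E$, let $\mathbf{B}_E$ be its closed unit ball, $\mathbf{S}_E$ its unit sphere, and $\mathcal{G}_E$ the group of isometric automorphisms (surjective linear isometries) $T\colon E\to E$; for $x\in E$ write $\mathcal{G}_E(x)=\{T(x): T\in\mathcal{G}_E\}$. The space $E$ is called convex-transitive if $\overline{\mathrm{conv}}(\mathcal{G}_E(x))=\mathbf{B}_E$ (norm-closed convex hull) for every $x\in\mathbf{S}_E$. *)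

theory Defs
  imports "HOL-Analysis.Analysis"
begin

unbundle cardinal_syntax

section \<open>Normed spaces with an explicit carrier\<close>

text \<open>
  The index set of the spaces below is the field of a cardinal that is a variable of the theorem, and
  the space of interest is a quotient by a subspace that depends on that cardinal, so
  these spaces cannot be types. A space is therefore a record with an explicit carrier.
\<close>

record 'v nspace =
  vcarrier :: "'v set"
  vadd :: "'v \<Rightarrow> 'v \<Rightarrow> 'v"
  vscale :: "real \<Rightarrow> 'v \<Rightarrow> 'v"
  vzero :: "'v"
  vnorm :: "'v \<Rightarrow> real"

definition vdist :: "('v, 'm) nspace_scheme \<Rightarrow> 'v \<Rightarrow> 'v \<Rightarrow> real" where
  "vdist E x y = vnorm E (vadd E x (vscale E (-1) y))"

locale normed_space_on =
  fixes E :: "'v nspace"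
  assumes add_closed: "\<lbrakk>x \<in> vcarrier E; y \<in> vcarrier E\<rbrakk> \<Longrightarrow> vadd E x y \<in> vcarrier E"
    and scale_closed: "x \<in> vcarrier E \<Longrightarrow> vscale E c x \<in> vcarrier E"
    and zero_closed: "vzero E \<in> vcarrier E"
    and add_assoc: "\<lbrakk>x \<in> vcarrier E; y \<in> vcarrier E; z \<in> vcarrier E\<rbrakk>
      \<Longrightarrow> vadd E (vadd E x y) z = vadd E x (vadd E y z)"
    and add_commute: "\<lbrakk>x \<in> vcarrier E; y \<in> vcarrier E\<rbrakk> \<Longrightarrow> vadd E x y = vadd E y x"
    and zero_add: "x \<in> vcarrier E \<Longrightarrow> vadd E (vzero E) x = x"
    and add_neg: "x \<in> vcarrier E \<Longrightarrow> vadd E x (vscale E (-1) x) = vzero E"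
    and scale_add_right: "\<lbrakk>x \<in> vcarrier E; y \<in> vcarrier E\<rbrakk>
      \<Longrightarrow> vscale E c (vadd E x y) = vadd E (vscale E c x) (vscale E c y)"
    and scale_add_left: "x \<in> vcarrier E \<Longrightarrow> vscale E (b + c) x = vadd E (vscale E b x) (vscale E c x)"
    and scale_scale: "x \<in> vcarrier E \<Longrightarrow> vscale E b (vscale E c x) = vscale E (b * c) x"
    and scale_one: "x \<in> vcarrier E \<Longrightarrow> vscale E 1 x = x"
    and norm_nonneg: "x \<in> vcarrier E \<Longrightarrow> 0 \<le> vnorm E x"
    and norm_eq_0: "x \<in> vcarrier E \<Longrightarrow> vnorm E x = 0 \<Longrightarrow> x = vzero E"
    and norm_scale: "x \<in> vcarrier E \<Longrightarrow> vnorm E (vscale E c x) = \<bar>c\<bar> * vnorm E x"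
    and norm_triangle: "\<lbrakk>x \<in> vcarrier E; y \<in> vcarrier E\<rbrakk>
      \<Longrightarrow> vnorm E (vadd E x y) \<le> vnorm E x + vnorm E y"

definition unit_ball :: "('v, 'm) nspace_scheme \<Rightarrow> 'v set" where
  "unit_ball E = {x \<in> vcarrier E. vnorm E x \<le> 1}"

definition unit_sphere :: "('v, 'm) nspace_scheme \<Rightarrow> 'v set" where
  "unit_sphere E = {x \<in> vcarrier E. vnorm E x = 1}"

text \<open>The values of an automorphism outside the carrier are unconstrained and irrelevant.\<close>

definition isometric_automorphisms :: "('v, 'm) nspace_scheme \<Rightarrow> ('v \<Rightarrow> 'v) set" where
  "isometric_automorphisms E = {T.
     T ` vcarrier E = vcarrier E \<and>
     (\<forall>x\<in>vcarrier E. \<forall>y\<in>vcarrier E. T (vadd E x y) = vadd E (T x) (T y)) \<and>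
     (\<forall>c. \<forall>x\<in>vcarrier E. T (vscale E c x) = vscale E c (T x)) \<and>
     (\<forall>x\<in>vcarrier E. vnorm E (T x) = vnorm E x)}"

definition isometry_orbit :: "('v, 'm) nspace_scheme \<Rightarrow> 'v \<Rightarrow> 'v set" where
  "isometry_orbit E x = {T x | T. T \<in> isometric_automorphisms E}"

definition convex_in :: "('v, 'm) nspace_scheme \<Rightarrow> 'v set \<Rightarrow> bool" where
  "convex_in E S \<longleftrightarrow> S \<subseteq> vcarrier E \<and>
     (\<forall>x\<in>S. \<forall>y\<in>S. \<forall>u\<ge>0. \<forall>v\<ge>0. u + v = 1 \<longrightarrow> vadd E (vscale E u x) (vscale E v y) \<in> S)"

definition norm_closure :: "('v, 'm) nspace_scheme \<Rightarrow> 'v set \<Rightarrow> 'v set" where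
  "norm_closure E S = {x \<in> vcarrier E. \<forall>e>0. \<exists>y\<in>S. vdist E x y < e}"

definition convex_transitive :: "('v, 'm) nspace_scheme \<Rightarrow> bool" where
  "convex_transitive E \<longleftrightarrow>
     (\<forall>x\<in>unit_sphere E. norm_closure E (convex_in E hull isometry_orbit E x) = unit_ball E)"

text \<open>On a normed space that is a type, this is the notion expressed by the library's
  \<^const>\<open>closure\<close> and \<^const>\<open>convex\<close> hull.\<close>

definition nspace_of_type :: "'a::real_normed_vector nspace" where
  "nspace_of_type = \<lparr>vcarrier = UNIV, vadd = (+), vscale = (*\<^sub>R), vzero = 0, vnorm = norm\<rparr>"

lemma convex_transitive_nspace_of_type:
  "convex_transitive (nspace_of_type :: 'a::real_normed_vector nspace) \<longleftrightarrow>
     (\<forall>x\<in>sphere (0::'a) 1.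
        closure (convex hull {T x | T. linear T \<and> surj T \<and> (\<forall>z. norm (T z) = norm z)}) = cball (0::'a) 1)"
proof -
  let ?E = "nspace_of_type :: 'a nspace"
  have "isometric_automorphisms ?E = {T. linear T \<and> surj T \<and> (\<forall>z. norm (T z) = norm z)}"
    by (auto simp: isometric_automorphisms_def nspace_of_type_def linear_iff)
  moreover have "convex_in ?E = convex"
    by (auto simp: fun_eq_iff convex_in_def nspace_of_type_def convex_def)
  moreover have "norm_closure ?E S = closure S" for S
    by (auto simp: norm_closure_def vdist_def nspace_of_type_def closure_approachable dist_norm norm_minus_commute)
  moreover have "unit_sphere ?E = sphere 0 1" "unit_ball ?E = cball 0 1"
    by (auto simp: unit_sphere_def unit_ball_def nspace_of_type_def)
  ultimately show ?thesis
    unfolding convex_transitive_def isometry_orbit_def by (simp only: mem_Collect_eq)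
qed


section \<open>Quotients\<close>

definition coset :: "('v, 'm) nspace_scheme \<Rightarrow> 'v set \<Rightarrow> 'v \<Rightarrow> 'v set" where
  "coset E W x = {vadd E x w | w. w \<in> W}"

text \<open>In the scalar multiplication, \<open>W\<close> is added so that \<open>0\<close> times a coset is \<open>W\<close> and not \<open>{0}\<close>.\<close>

definition quotient_space :: "('v, 'm) nspace_scheme \<Rightarrow> 'v set \<Rightarrow> 'v set nspace" where
  "quotient_space E W =
     \<lparr>vcarrier = coset E W ` vcarrier E,
      vadd = (\<lambda>A B. {vadd E a b | a b. a \<in> A \<and> b \<in> B}),
      vscale = (\<lambda>c A. {vadd E (vscale E c a) w | a w. a \<in> A \<and> w \<in> W}),
      vzero = W,
      vnorm = (\<lambda>A. INF a\<in>A. vnorm E a)\<rparr>"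


section \<open>Spaces of bounded functions\<close>

text \<open>
  A cardinal is a relation \<open>m\<close> with \<^term>\<open>Card_order m\<close>, and its underlying set is \<^term>\<open>Field m\<close>.
  A function on this set is represented by its extension by zero to the whole type.
\<close>

definition linf :: "'i rel \<Rightarrow> ('i \<Rightarrow> real) nspace" where
  "linf m =
     \<lparr>vcarrier = {x. bounded (x ` Field m) \<and> (\<forall>i. i \<notin> Field m \<longrightarrow> x i = 0)},
      vadd = (\<lambda>x y i. x i + y i),
      vscale = (\<lambda>c x i. c * x i),
      vzero = (\<lambda>i. 0),
      vnorm = (\<lambda>x. SUP i\<in>Field m. \<bar>x i\<bar>)\<rparr>"

definition linf_supp :: "'l rel \<Rightarrow> 'i rel \<Rightarrow> ('i \<Rightarrow> real) nspace" where
  "linf_supp l m = (linf m)\<lparr>vcarrier := {x \<in> vcarrier (linf m). |{i. x i \<noteq> 0}| \<le>o l}\<rparr>"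


section \<open>The spaces above are normed spaces\<close>

context normed_space_on
begin

lemma add_zero: "x \<in> vcarrier E \<Longrightarrow> vadd E x (vzero E) = x"
  using add_commute zero_add zero_closed by metis

lemma add_left_commute:
  "\<lbrakk>x \<in> vcarrier E; y \<in> vcarrier E; z \<in> vcarrier E\<rbrakk> \<Longrightarrow> vadd E x (vadd E y z) = vadd E y (vadd E x z)"
  by (metis add_assoc add_commute)

lemma neg_add: "x \<in> vcarrier E \<Longrightarrow> vadd E (vscale E (-1) x) x = vzero E"
  by (metis add_commute add_neg scale_closed)

lemma add_neg_cancel:
  "\<lbrakk>x \<in> vcarrier E; y \<in> vcarrier E\<rbrakk> \<Longrightarrow> vadd E x (vadd E (vscale E (-1) x) y) = y"
  by (metis add_assoc add_neg scale_closed zero_add)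

lemma neg_add_cancel:
  "\<lbrakk>x \<in> vcarrier E; y \<in> vcarrier E\<rbrakk> \<Longrightarrow> vadd E (vscale E (-1) x) (vadd E x y) = y"
  by (metis add_assoc neg_add scale_closed zero_add)

lemma norm_zero: "vnorm E (vzero E) = 0"
  using norm_scale[of "vzero E" 2] scale_add_left[of "vzero E" 1 1] zero_closed
  by (simp add: scale_one zero_add)

lemma scale_zero_left: "x \<in> vcarrier E \<Longrightarrow> vscale E 0 x = vzero E"
  using norm_scale[of x 0] norm_eq_0 scale_closed by simp

context
  fixes W
  assumes W_sub: "W \<subseteq> vcarrier E"
    and W_zero: "vzero E \<in> W"
    and W_add: "\<And>x y. \<lbrakk>x \<in> W; y \<in> W\<rbrakk> \<Longrightarrow> vadd E x y \<in> W"
    and W_scale: "\<And>c x. x \<in> W \<Longrightarrow> vscale E c x \<in> W"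
    and W_closed: "norm_closure E W \<subseteq> W"
begin

lemma W_carrier: "w \<in> W \<Longrightarrow> w \<in> vcarrier E"
  using W_sub by auto

lemma mem_coset_self: "x \<in> vcarrier E \<Longrightarrow> x \<in> coset E W x"
  unfolding coset_def using W_zero add_zero by force

lemma coset_sub: "x \<in> vcarrier E \<Longrightarrow> coset E W x \<subseteq> vcarrier E"
  by (auto simp: coset_def add_closed W_carrier)

lemma coset_W: assumes w: "w \<in> W" shows "coset E W w = W"
proof
  show "coset E W w \<subseteq> W"
    using w by (auto simp: coset_def W_add)
  show "W \<subseteq> coset E W w"
  proof
    fix y assume "y \<in> W"
    then have "y = vadd E w (vadd E (vscale E (-1) w) y)" "vadd E (vscale E (-1) w) y \<in> W"
      using w by (simp_all add: add_neg_cancel W_carrier W_add W_scale)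
    then show "y \<in> coset E W w"
      unfolding coset_def by blast
  qed
qed

lemma coset_add:
  assumes "x \<in> vcarrier E" "y \<in> vcarrier E"
  shows "vadd (quotient_space E W) (coset E W x) (coset E W y) = coset E W (vadd E x y)"
proof -
  have eq: "vadd E (vadd E x v) (vadd E y w) = vadd E (vadd E x y) (vadd E v w)" if "v \<in> W" "w \<in> W" for v w
    using assms that by (simp add: add_assoc add_left_commute add_closed W_carrier)
  show ?thesis
  proof
    show "vadd (quotient_space E W) (coset E W x) (coset E W y) \<subseteq> coset E W (vadd E x y)"
      unfolding coset_def quotient_space_def using eq W_add by auto
    have "vadd E (vadd E x y) w = vadd E x (vadd E y w)" if "w \<in> W" for w
      using assms that by (simp add: add_assoc W_carrier)
    then show "coset E W (vadd E x y) \<subseteq> vadd (quotient_space E W) (coset E W x) (coset E W y)"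
      using mem_coset_self[OF assms(1)] by (auto simp: coset_def quotient_space_def)
  qed
qed

lemma coset_scale:
  assumes "x \<in> vcarrier E"
  shows "vscale (quotient_space E W) c (coset E W x) = coset E W (vscale E c x)"
proof -
  have eq: "vadd E (vscale E c (vadd E x v)) w = vadd E (vscale E c x) (vadd E (vscale E c v) w)"
    if "v \<in> W" "w \<in> W" for v w
    using assms that by (simp add: scale_add_right add_assoc scale_closed W_carrier)
  show ?thesis
  proof
    show "vscale (quotient_space E W) c (coset E W x) \<subseteq> coset E W (vscale E c x)"
      unfolding coset_def quotient_space_def using eq W_add W_scale by auto
    show "coset E W (vscale E c x) \<subseteq> vscale (quotient_space E W) c (coset E W x)"
      using mem_coset_self[OF assms] by (auto simp: coset_def quotient_space_def)
  qed
qed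

lemma coset_norm_le:
  assumes "x \<in> vcarrier E" "a \<in> coset E W x"
  shows "vnorm (quotient_space E W) (coset E W x) \<le> vnorm E a"
  unfolding quotient_space_def using assms coset_sub norm_nonneg
  by (auto intro!: cINF_lower bdd_belowI[of _ 0])

lemma coset_norm_less:
  assumes "x \<in> vcarrier E" "vnorm (quotient_space E W) (coset E W x) < r"
  shows "\<exists>a\<in>coset E W x. vnorm E a < r"
proof (rule ccontr)
  assume "\<not> ?thesis"
  then have "r \<le> (INF a\<in>coset E W x. vnorm E a)"
    using mem_coset_self[OF assms(1)] by (intro cINF_greatest) force+
  then show False
    using assms(2) by (simp add: quotient_space_def)
qed

lemma coset_norm_greatest:
  assumes "x \<in> vcarrier E" "\<And>a. a \<in> coset E W x \<Longrightarrow> r \<le> vnorm E a"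
  shows "r \<le> vnorm (quotient_space E W) (coset E W x)"
  unfolding quotient_space_def using assms mem_coset_self by (auto intro!: cINF_greatest)

lemma coset_norm_0:
  assumes x: "x \<in> vcarrier E" and 0: "vnorm (quotient_space E W) (coset E W x) = 0"
  shows "x \<in> W"
proof -
  have "\<exists>y\<in>W. vdist E x y < e" if "e > 0" for e
  proof -
    obtain w where "w \<in> W" "vnorm E (vadd E x w) < e"
      using coset_norm_less[OF x] 0 \<open>e > 0\<close> by (auto simp: coset_def)
    then show ?thesis
      by (intro bexI[of _ "vscale E (-1) w"])
        (auto simp: vdist_def W_scale scale_scale scale_one W_carrier)
  qed
  then show ?thesis
    using W_closed x by (auto simp: norm_closure_def)
qed

lemma coset_norm_triangle:
  assumes x: "x \<in> vcarrier E" and y: "y \<in> vcarrier E"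
  shows "vnorm (quotient_space E W) (coset E W (vadd E x y))
    \<le> vnorm (quotient_space E W) (coset E W x) + vnorm (quotient_space E W) (coset E W y)"
    (is "?n (vadd E x y) \<le> ?n x + ?n y")
proof (rule field_le_epsilon)
  fix e :: real assume "e > 0"
  obtain a where a: "a \<in> coset E W x" "vnorm E a < ?n x + e/2"
    using coset_norm_less[OF x, of "?n x + e/2"] \<open>e > 0\<close> by auto
  obtain b where b: "b \<in> coset E W y" "vnorm E b < ?n y + e/2"
    using coset_norm_less[OF y, of "?n y + e/2"] \<open>e > 0\<close> by auto
  have "vadd E a b \<in> coset E W (vadd E x y)"
    using a b coset_add[OF x y] by (auto simp: quotient_space_def)
  then have "?n (vadd E x y) \<le> vnorm E (vadd E a b)"
    by (intro coset_norm_le add_closed x y)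
  also have "\<dots> \<le> vnorm E a + vnorm E b"
    using a b coset_sub x y by (intro norm_triangle) auto
  finally show "?n (vadd E x y) \<le> ?n x + ?n y + e"
    using a b by simp
qed

lemma coset_norm_scale_le:
  assumes x: "x \<in> vcarrier E"
  shows "vnorm (quotient_space E W) (coset E W (vscale E c x))
    \<le> \<bar>c\<bar> * vnorm (quotient_space E W) (coset E W x)"
    (is "?n (vscale E c x) \<le> \<bar>c\<bar> * ?n x")
proof (rule field_le_epsilon)
  fix e :: real assume "e > 0"
  define d where "d = e / (\<bar>c\<bar> + 1)"
  have "d > 0" "\<bar>c\<bar> * d \<le> e"
    using \<open>e > 0\<close> by (auto simp: d_def field_simps)
  obtain a where a: "a \<in> coset E W x" "vnorm E a < ?n x + d"
    using coset_norm_less[OF x, of "?n x + d"] \<open>d > 0\<close> by auto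
  then have aE: "a \<in> vcarrier E"
    using coset_sub x by auto
  then have "vadd E (vscale E c a) (vzero E) \<in> vscale (quotient_space E W) c (coset E W x)"
    using a W_zero by (auto simp: quotient_space_def)
  then have "vscale E c a \<in> coset E W (vscale E c x)"
    using aE by (simp add: coset_scale[OF x] add_zero scale_closed)
  then have "?n (vscale E c x) \<le> \<bar>c\<bar> * vnorm E a"
    using coset_norm_le[of "vscale E c x" "vscale E c a"] x aE by (simp add: scale_closed norm_scale)
  also have "\<dots> \<le> \<bar>c\<bar> * (?n x + d)"
    using a by (intro mult_left_mono) auto
  finally show "?n (vscale E c x) \<le> \<bar>c\<bar> * ?n x + e"
    using \<open>\<bar>c\<bar> * d \<le> e\<close> by (simp add: algebra_simps)
qed

lemma coset_norm_scale:
  assumes x: "x \<in> vcarrier E"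
  shows "vnorm (quotient_space E W) (coset E W (vscale E c x))
    = \<bar>c\<bar> * vnorm (quotient_space E W) (coset E W x)"
    (is "?n (vscale E c x) = \<bar>c\<bar> * ?n x")
proof (rule antisym[OF coset_norm_scale_le[OF x]])
  show "\<bar>c\<bar> * ?n x \<le> ?n (vscale E c x)"
  proof (cases "c = 0")
    case True
    then show ?thesis
      using coset_norm_greatest[of "vscale E c x" 0] coset_sub norm_nonneg x scale_closed by auto
  next
    case False
    have "?n (vscale E (1/c) (vscale E c x)) \<le> \<bar>1/c\<bar> * ?n (vscale E c x)"
      by (intro coset_norm_scale_le scale_closed x)
    then show ?thesis
      using False x by (simp add: scale_scale scale_one field_simps)
  qed
qed

lemma normed_space_on_quotient: "normed_space_on (quotient_space E W)"
proof
  let ?Q = "quotient_space E W"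
  have carr: "A \<in> vcarrier ?Q \<Longrightarrow> (\<And>x. x \<in> vcarrier E \<Longrightarrow> A = coset E W x \<Longrightarrow> P) \<Longrightarrow> P" for A P
    by (auto simp: quotient_space_def)
  have coset_in: "x \<in> vcarrier E \<Longrightarrow> coset E W x \<in> vcarrier ?Q" for x
    by (auto simp: quotient_space_def)
  have zero: "vzero ?Q = coset E W (vzero E)"
    using coset_W[OF W_zero] by (simp add: quotient_space_def)
  note simps = zero coset_in coset_add coset_scale coset_norm_scale add_closed scale_closed zero_closed
    zero_add add_neg scale_scale scale_one
  fix A B C b c
  show "vzero ?Q \<in> vcarrier ?Q"
    by (simp add: simps)
  assume "A \<in> vcarrier ?Q"
  then obtain x where x: "x \<in> vcarrier E" "A = coset E W x"
    by (rule carr)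
  show "vscale ?Q c A \<in> vcarrier ?Q" "vadd ?Q (vzero ?Q) A = A"
    "vadd ?Q A (vscale ?Q (-1) A) = vzero ?Q"
    "vscale ?Q b (vscale ?Q c A) = vscale ?Q (b * c) A" "vscale ?Q 1 A = A"
    "vnorm ?Q (vscale ?Q c A) = \<bar>c\<bar> * vnorm ?Q A"
    using x by (simp_all add: simps)
  show "vscale ?Q (b + c) A = vadd ?Q (vscale ?Q b A) (vscale ?Q c A)"
    using x by (simp add: simps scale_add_left)
  show "0 \<le> vnorm ?Q A"
    unfolding x(2) using x(1) coset_sub norm_nonneg by (intro coset_norm_greatest) auto
  show "A = vzero ?Q" if "vnorm ?Q A = 0"
    using x that coset_norm_0[of x] by (simp add: zero coset_W W_zero)
  assume "B \<in> vcarrier ?Q"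
  then obtain y where y: "y \<in> vcarrier E" "B = coset E W y"
    by (rule carr)
  show "vadd ?Q A B \<in> vcarrier ?Q"
    using x y by (simp add: simps)
  show "vscale ?Q c (vadd ?Q A B) = vadd ?Q (vscale ?Q c A) (vscale ?Q c B)"
    using x y by (simp add: simps scale_add_right)
  show "vadd ?Q A B = vadd ?Q B A"
    using x y add_commute[of x y] by (simp add: coset_add)
  show "vnorm ?Q (vadd ?Q A B) \<le> vnorm ?Q A + vnorm ?Q B"
    using x y by (simp add: coset_add coset_norm_triangle)
  assume "C \<in> vcarrier ?Q"
  then obtain z where "z \<in> vcarrier E" "C = coset E W z"
    by (rule carr)
  then show "vadd ?Q (vadd ?Q A B) C = vadd ?Q A (vadd ?Q B C)"
    using x y by (simp add: coset_add add_closed add_assoc)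
qed

end

end

lemma linf_carrier_iff:
  "x \<in> vcarrier (linf m) \<longleftrightarrow> (\<exists>b. \<forall>i\<in>Field m. \<bar>x i\<bar> \<le> b) \<and> (\<forall>i. i \<notin> Field m \<longrightarrow> x i = 0)"
  by (auto simp: linf_def bounded_iff)

lemma linf_norm_ge:
  assumes "x \<in> vcarrier (linf m)" "i \<in> Field m"
  shows "\<bar>x i\<bar> \<le> vnorm (linf m) x"
proof -
  have "bdd_above ((\<lambda>i. \<bar>x i\<bar>) ` Field m)"
    using assms by (auto simp: linf_carrier_iff bdd_above_def)
  then show ?thesis
    using cSUP_upper[OF assms(2)] by (auto simp: linf_def)
qed

lemma linf_norm_le:
  assumes "Field m \<noteq> {}" "\<And>i. i \<in> Field m \<Longrightarrow> \<bar>x i\<bar> \<le> b"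
  shows "vnorm (linf m) x \<le> b"
  using assms by (auto simp: linf_def intro!: cSUP_least)

lemma linf_ops [simp]:
  "vadd (linf m) = (\<lambda>x y i. x i + y i)" "vscale (linf m) = (\<lambda>c x i. c * x i)" "vzero (linf m) = (\<lambda>i. 0)"
  by (simp_all add: linf_def)

lemma normed_space_on_linf:
  assumes "Field m \<noteq> {}"
  shows "normed_space_on (linf m)"
proof
  fix x y z :: "'a \<Rightarrow> real" and b c :: real
  show "vzero (linf m) \<in> vcarrier (linf m)"
    by (auto simp: linf_carrier_iff)
  assume x: "x \<in> vcarrier (linf m)"
  then obtain B where B: "\<And>i. i \<in> Field m \<Longrightarrow> \<bar>x i\<bar> \<le> B"
    by (auto simp: linf_carrier_iff)
  show cx: "vscale (linf m) c x \<in> vcarrier (linf m)" for c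
    using x B by (auto simp: linf_carrier_iff abs_mult intro!: exI[of _ "\<bar>c\<bar> * B"] mult_left_mono)
  obtain i0 where i0: "i0 \<in> Field m" using assms by auto
  show nn: "0 \<le> vnorm (linf m) x"
    using linf_norm_ge[OF x i0] by linarith
  show "vnorm (linf m) x = 0 \<Longrightarrow> x = vzero (linf m)"
    using linf_norm_ge[OF x] x by (fastforce simp: linf_carrier_iff)
  have le: "vnorm (linf m) (vscale (linf m) c x) \<le> \<bar>c\<bar> * vnorm (linf m) x"
    if "x \<in> vcarrier (linf m)" for c x
    using linf_norm_ge[OF that] by (intro linf_norm_le[OF assms]) (auto simp: abs_mult intro!: mult_left_mono)
  show "vnorm (linf m) (vscale (linf m) c x) = \<bar>c\<bar> * vnorm (linf m) x"
  proof (cases "c = 0")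
    case True
    then show ?thesis using assms by (simp add: linf_def)
  next
    case False
    then show ?thesis
      using le[OF x, of c] le[OF cx, of "1/c" c] by (simp add: field_simps)
  qed
  show "vadd (linf m) (vzero (linf m)) x = x"
    "vadd (linf m) x (vscale (linf m) (-1) x) = vzero (linf m)"
    "vscale (linf m) (b + c) x = vadd (linf m) (vscale (linf m) b x) (vscale (linf m) c x)"
    "vscale (linf m) b (vscale (linf m) c x) = vscale (linf m) (b * c) x" "vscale (linf m) 1 x = x"
    by (simp_all add: algebra_simps)
  assume y: "y \<in> vcarrier (linf m)"
  show "vnorm (linf m) (vadd (linf m) x y) \<le> vnorm (linf m) x + vnorm (linf m) y"
  proof (intro linf_norm_le[OF assms])
    fix i assume "i \<in> Field m"
    then show "\<bar>vadd (linf m) x y i\<bar> \<le> vnorm (linf m) x + vnorm (linf m) y"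
      using linf_norm_ge[OF x, of i] linf_norm_ge[OF y, of i] by simp
  qed
  obtain C where C: "\<And>i. i \<in> Field m \<Longrightarrow> \<bar>y i\<bar> \<le> C"
    using y by (auto simp: linf_carrier_iff)
  have "\<bar>x i + y i\<bar> \<le> B + C" if "i \<in> Field m" for i
    using B[OF that] C[OF that] by simp
  then show "vadd (linf m) x y \<in> vcarrier (linf m)"
    using x y by (auto simp: linf_carrier_iff)
qed (simp_all add: algebra_simps)

lemma linf_supp_simps [simp]:
  "vcarrier (linf_supp l m) = {x \<in> vcarrier (linf m). |{i. x i \<noteq> 0}| \<le>o l}"
  "vadd (linf_supp l m) = vadd (linf m)" "vscale (linf_supp l m) = vscale (linf m)"
  "vzero (linf_supp l m) = vzero (linf m)" "vnorm (linf_supp l m) = vnorm (linf m)"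
  by (simp_all add: linf_supp_def)

lemma supp_add:
  fixes x y :: "'i \<Rightarrow> real"
  assumes "Cinfinite l" "|{i. x i \<noteq> 0}| \<le>o l" "|{i. y i \<noteq> 0}| \<le>o l"
  shows "|{i. x i + y i \<noteq> 0}| \<le>o l"
proof -
  have "|{i. x i \<noteq> 0} \<union> {i. y i \<noteq> 0}| \<le>o l"
    using assms by (intro Un_Cinfinite_bound) auto
  then show ?thesis
    by (rule ordLeq_transitive[OF card_of_mono1, rotated]) auto
qed

lemma supp_scale:
  fixes x :: "'i \<Rightarrow> real"
  assumes "|{i. x i \<noteq> 0}| \<le>o l"
  shows "|{i. c * x i \<noteq> 0}| \<le>o l"
  using assms by (rule ordLeq_transitive[OF card_of_mono1, rotated]) auto

lemma supp_zero: "Cinfinite l \<Longrightarrow> |{}| \<le>o l"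
  by (simp add: card_of_empty1 card_order_on_well_order_on)

lemma normed_space_on_linf_supp:
  assumes l: "Cinfinite l" and m: "Field m \<noteq> {}"
  shows "normed_space_on (linf_supp l m)"
proof -
  interpret normed_space_on "linf m" by (rule normed_space_on_linf[OF m])
  show ?thesis
    by unfold_locales
      (use l in \<open>simp_all add: supp_add supp_scale supp_scale[simplified] supp_zero add_closed[simplified] scale_closed[simplified]
        zero_closed[simplified] norm_nonneg norm_eq_0[simplified] norm_scale[simplified] norm_triangle[simplified]
        algebra_simps\<close>)
qed

lemma linf_supp_closed:
  assumes l: "Cinfinite l"
  shows "norm_closure (linf_supp l' m) (vcarrier (linf_supp l m)) \<subseteq> vcarrier (linf_supp l m)"
proof
  fix x assume x: "x \<in> norm_closure (linf_supp l' m) (vcarrier (linf_supp l m))"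
  then have xm: "x \<in> vcarrier (linf m)"
    and "\<forall>n. \<exists>y. y \<in> vcarrier (linf_supp l m) \<and> vdist (linf_supp l' m) x y < inverse (real (Suc n))"
    by (auto simp: norm_closure_def)
  then obtain y where y: "\<And>n. y n \<in> vcarrier (linf_supp l m)"
    and d: "\<And>n. vdist (linf_supp l' m) x (y n) < inverse (real (Suc n))"
    by metis
  have "{i. x i \<noteq> 0} \<subseteq> (\<Union>n. {i. y n i \<noteq> 0})"
  proof
    fix i assume "i \<in> {i. x i \<noteq> 0}"
    then have i: "x i \<noteq> 0" "i \<in> Field m"
      using xm by (auto simp: linf_carrier_iff)
    then obtain n where n: "inverse (real (Suc n)) < \<bar>x i\<bar>"
      using reals_Archimedean[of "\<bar>x i\<bar>"] by auto
    interpret normed_space_on "linf m"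
      using i by (intro normed_space_on_linf) auto
    have "(\<lambda>j. x j + -1 * y n j) \<in> vcarrier (linf m)"
      using add_closed[OF xm scale_closed[of "y n" "-1"]] y[of n] by simp
    from linf_norm_ge[OF this i(2)] d[of n] n have "y n i \<noteq> 0"
      by (auto simp: vdist_def)
    then show "i \<in> (\<Union>n. {i. y n i \<noteq> 0})" by auto
  qed
  moreover have "|\<Union>n. {i. y n i \<noteq> 0}| \<le>o l"
  proof (rule UNION_Cinfinite_bound)
    show "|UNIV :: nat set| \<le>o l"
      using l natLeq_ordLeq_cinfinite card_of_nat ordIso_ordLeq_trans by blast
  qed (use y l in auto)
  ultimately show "x \<in> vcarrier (linf_supp l m)"
    using xm by (auto intro: ordLeq_transitive[OF card_of_mono1])
qed

lemma normed_space_on_linf_quotient: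
  assumes "Cinfinite l" "Cinfinite l'" "l \<le>o l'" "Field m \<noteq> {}"
  shows "normed_space_on (quotient_space (linf_supp l' m) (vcarrier (linf_supp l m)))"
proof -
  interpret S: normed_space_on "linf_supp l m"
    using assms by (intro normed_space_on_linf_supp)
  interpret normed_space_on "linf_supp l' m"
    using assms by (intro normed_space_on_linf_supp)
  show ?thesis
  proof (rule normed_space_on_quotient)
    show "vcarrier (linf_supp l m) \<subseteq> vcarrier (linf_supp l' m)"
      using assms ordLeq_transitive by auto
  qed (use S.zero_closed S.add_closed S.scale_closed linf_supp_closed[OF assms(1)] in simp_all)
qed

lemma normed_space_on_cardSuc_quotient:
  assumes k: "Cinfinite k"
  shows "normed_space_on
    (quotient_space
      (linf_supp (cardSuc k) (cardSuc (cardSuc k)))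
      (vcarrier (linf_supp k (cardSuc (cardSuc k)))))"
proof (rule normed_space_on_linf_quotient[OF k])
  show k': "Cinfinite (cardSuc k)"
    using k by (rule Cinfinite_cardSuc)
  show "k \<le>o cardSuc k"
    using k cardSuc_ordLeq by blast
  have "Cinfinite (cardSuc (cardSuc k))"
    using k' by (rule Cinfinite_cardSuc)
  then show "Field (cardSuc (cardSuc k)) \<noteq> {}"
    by (auto simp: cinfinite_def)
qed

end

theory Submission
  imports Defs
begin

text \<open>
  Let \<open>M\<close> be the index set. The norm of the coset of \<open>x\<close> is an essential supremum: it is at most \<open>r\<close>
  exactly when \<open>\<bar>x\<bar>\<close> exceeds \<open>r\<close> on at most \<open>\<kappa>\<close> indices (\<open>Q_norm_le_iff\<close>). So a vector of the unit
  sphere has a representative \<open>x\<close> with values in \<open>[-1, 1]\<close> such that \<open>A = {i. 1 - d < \<bar>x i\<bar>}\<close> has more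
  than \<open>\<kappa>\<close> elements, hence exactly \<open>\<kappa>\<^sup>+\<close>, because the whole support \<open>S\<close> of \<open>x\<close> has at most \<open>\<kappa>\<^sup>+\<close>
  elements. Let \<open>y\<close> with values in \<open>[-1, 1]\<close> represent a target in the unit ball, and let \<open>B\<close> be
  the union of \<open>A\<close> and the support of \<open>y\<close>, which also has \<open>\<kappa>\<^sup>+\<close> elements.

  Permuting coordinates and changing signs preserves both \<open>\<ell>\<^sup>\<infinity>\<close> spaces and therefore acts
  isometrically on the quotient (\<open>signed_perm_orbit\<close>). Since \<open>M\<close> is larger than \<open>\<kappa>\<^sup>+\<close>, there are
  permutations of \<open>M\<close> that all carry \<open>A\<close> onto \<open>B\<close> but carry \<open>S - A\<close> to pairwise disjoint sets outside
  \<open>B\<close> (\<open>almost_disjoint_permutations\<close>). Take the mean of \<open>N\<close> copies of \<open>x\<close> moved in this way. Off \<open>B\<close>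
  at most one of them is nonzero at any index, so the mean is at most \<open>1 / N\<close> there, whereas \<open>y\<close>
  vanishes. On \<open>B\<close> every copy has absolute value in \<open>(1 - d, 1]\<close>, and its signs are free, so at each
  index they can be chosen such that their mean is within \<open>2 / N\<close> of \<open>y\<close>
  (\<open>signs_with_prescribed_mean\<close>). The mean is thus within \<open>d + 2 / N\<close> of \<open>y\<close>.

  The argument applies to every \<open>M\<close> of cardinality greater than \<open>\<kappa>\<^sup>+\<close>.
\<close>

section \<open>Geometry of normed spaces with a carrier\<close>

context normed_space_on
begin

lemma convex_in_unit_ball: "convex_in E (unit_ball E)"
proof -
  have "vnorm E (vadd E (vscale E u x) (vscale E v y)) \<le> 1"
    if "x \<in> vcarrier E" "vnorm E x \<le> 1" "y \<in> vcarrier E" "vnorm E y \<le> 1" "0 \<le> u" "0 \<le> v" "u + v = 1"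
    for x y u v
  proof -
    have "vnorm E (vadd E (vscale E u x) (vscale E v y)) \<le> u * vnorm E x + v * vnorm E y"
      using norm_triangle[of "vscale E u x" "vscale E v y"] that by (simp add: scale_closed norm_scale)
    also have "\<dots> \<le> u * 1 + v * 1"
      using that by (intro add_mono mult_left_mono) auto
    finally show ?thesis using that by simp
  qed
  then show ?thesis
    by (auto simp: convex_in_def unit_ball_def add_closed scale_closed)
qed

lemma norm_closure_unit_ball: "norm_closure E (unit_ball E) \<subseteq> unit_ball E"
proof
  fix x assume x: "x \<in> norm_closure E (unit_ball E)"
  then have xE: "x \<in> vcarrier E" by (simp add: norm_closure_def)
  have "vnorm E x \<le> 1"
  proof (rule field_le_epsilon)
    fix e :: real assume "e > 0"
    then obtain y where y: "y \<in> vcarrier E" "vnorm E y \<le> 1" "vdist E x y < e"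
      using x by (auto simp: norm_closure_def unit_ball_def)
    have "x = vadd E y (vadd E x (vscale E (-1) y))"
      using xE y by (metis add_commute add_left_commute add_neg add_zero scale_closed)
    then have "vnorm E x \<le> vnorm E y + vdist E x y"
      using norm_triangle[of y "vadd E x (vscale E (-1) y)"] xE y
      by (simp add: vdist_def add_closed scale_closed)
    then show "vnorm E x \<le> 1 + e" using y by simp
  qed
  then show "x \<in> unit_ball E" using xE by (simp add: unit_ball_def)
qed

lemma closed_hull_orbit_subset:
  assumes "x \<in> unit_sphere E"
  shows "norm_closure E (convex_in E hull isometry_orbit E x) \<subseteq> unit_ball E"
proof -
  have "isometry_orbit E x \<subseteq> unit_ball E"
    using assms by (auto simp: isometry_orbit_def isometric_automorphisms_def unit_sphere_def unit_ball_def)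
  then have "convex_in E hull isometry_orbit E x \<subseteq> unit_ball E"
    by (intro hull_minimal convex_in_unit_ball)
  then have "norm_closure E (convex_in E hull isometry_orbit E x) \<subseteq> norm_closure E (unit_ball E)"
    by (fastforce simp: norm_closure_def)
  then show ?thesis using norm_closure_unit_ball by blast
qed

end

text \<open>The operations of the quotient are defined on sets of vectors, so the induced map on cosets is
  the image map of \<open>T\<close>. The hypothesis is \<open>T ` W = W\<close> because an inclusion would not make the image of
  a coset a full coset.\<close>

lemma isometric_automorphism_quotient:
  assumes T: "T \<in> isometric_automorphisms E" and W: "W \<subseteq> vcarrier E" "T ` W = W"
    and E: "normed_space_on E"
  shows "(`) T \<in> isometric_automorphisms (quotient_space E W)"
    and "x \<in> vcarrier E \<Longrightarrow> T ` coset E W x = coset E W (T x)"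
proof -
  interpret normed_space_on E by (rule E)
  have surj: "T ` vcarrier E = vcarrier E"
    and add: "\<And>x y. x \<in> vcarrier E \<Longrightarrow> y \<in> vcarrier E \<Longrightarrow> T (vadd E x y) = vadd E (T x) (T y)"
    and scale: "\<And>c x. x \<in> vcarrier E \<Longrightarrow> T (vscale E c x) = vscale E c (T x)"
    and norm: "\<And>x. x \<in> vcarrier E \<Longrightarrow> vnorm E (T x) = vnorm E x"
    using T by (auto simp: isometric_automorphisms_def)
  let ?Q = "quotient_space E W"
  have sub: "A \<subseteq> vcarrier E" if "A \<in> vcarrier ?Q" for A
    using that W by (auto simp: quotient_space_def coset_def intro!: add_closed)
  have coset: "T ` coset E W x = coset E W (T x)" if "x \<in> vcarrier E" for x
  proof -
    have "T ` coset E W x = vadd E (T x) ` T ` W"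
      unfolding coset_def image_image Setcompr_eq_image using that W by (intro image_cong refl add) auto
    then show ?thesis using W by (auto simp: coset_def)
  qed
  then show "x \<in> vcarrier E \<Longrightarrow> T ` coset E W x = coset E W (T x)" .
  have "(`) T ` vcarrier ?Q = coset E W ` T ` vcarrier E"
    by (auto simp: quotient_space_def coset image_image)
  then have 1: "(`) T ` vcarrier ?Q = vcarrier ?Q"
    by (simp add: surj quotient_space_def)
  have 2: "T ` vadd ?Q A B = vadd ?Q (T ` A) (T ` B)" if "A \<in> vcarrier ?Q" "B \<in> vcarrier ?Q" for A B
    using sub[OF that(1)] sub[OF that(2)] add by (auto simp: quotient_space_def) (force simp: image_iff subset_iff)+
  have 3: "T ` vscale ?Q c A = vscale ?Q c (T ` A)" if "A \<in> vcarrier ?Q" for c A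
  proof -
    have "T ` vscale ?Q c A = (\<lambda>(a, w). T (vadd E (vscale E c a) w)) ` (A \<times> W)"
      by (force simp: quotient_space_def image_iff)
    also have "\<dots> = (\<lambda>(a, w). vadd E (vscale E c (T a)) (T w)) ` (A \<times> W)"
      using sub[OF that] W by (intro image_cong) (auto simp: add scale scale_closed subset_iff)
    also have "\<dots> = (\<lambda>(a, w). vadd E (vscale E c a) w) ` (T ` A \<times> T ` W)"
      by (force simp: image_iff)
    also have "\<dots> = vscale ?Q c (T ` A)"
      unfolding W(2) by (force simp: quotient_space_def image_iff)
    finally show ?thesis .
  qed
  have 4: "vnorm ?Q (T ` A) = vnorm ?Q A" if "A \<in> vcarrier ?Q" for A
    using sub[OF that] norm by (auto simp: quotient_space_def image_image subset_iff intro!: INF_cong)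
  show "(`) T \<in> isometric_automorphisms ?Q"
    using 1 2 3 4 by (simp add: isometric_automorphisms_def)
qed

section \<open>Signed permutations\<close>

definition signed_perm :: "('i \<Rightarrow> real) \<Rightarrow> ('i \<Rightarrow> 'i) \<Rightarrow> ('i \<Rightarrow> real) \<Rightarrow> 'i \<Rightarrow> real" where
  "signed_perm s p x = (\<lambda>i. s i * x (p i))"

lemma signed_perm_carrier:
  assumes p: "p permutes Field m" and s: "\<And>i. \<bar>s i\<bar> = 1" and x: "x \<in> vcarrier (linf_supp l m)"
  shows "signed_perm s p x \<in> vcarrier (linf_supp l m)"
proof -
  have s0: "s i \<noteq> 0" for i using s[of i] by auto
  have "{i. s i * x (p i) \<noteq> 0} = inv p ` {i. x i \<noteq> 0}"
    using s0 by (force simp: permutes_inverses[OF p] image_iff)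
  then have "|{i. s i * x (p i) \<noteq> 0}| \<le>o |{i. x i \<noteq> 0}|"
    by (simp only: card_of_image)
  moreover have "\<bar>s i * x (p i)\<bar> = \<bar>x (p i)\<bar>" for i
    by (simp add: abs_mult s)
  moreover obtain b where "\<forall>i\<in>Field m. \<bar>x i\<bar> \<le> b"
    using x by (auto simp: linf_carrier_iff)
  then have "\<forall>i\<in>Field m. \<bar>x (p i)\<bar> \<le> b"
    by (simp add: permutes_in_image[OF p])
  ultimately show ?thesis
    using x permutes_not_in[OF p]
    by (auto simp: signed_perm_def linf_carrier_iff s0 elim: ordLeq_transitive)
qed

text \<open>The support bound \<open>l\<close> is arbitrary: for the larger bound this gives an isometry of the ambient
  space, for the smaller one the invariance of the subspace that is factored out.\<close>

lemma signed_perm_isometric: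
  assumes p: "p permutes Field m" and s: "\<And>i. \<bar>s i\<bar> = 1"
  shows "signed_perm s p \<in> isometric_automorphisms (linf_supp l m)"
proof -
  let ?E = "linf_supp l m" and ?T = "signed_perm s p"
  have "x \<in> ?T ` vcarrier ?E" if x: "x \<in> vcarrier ?E" for x
  proof (rule image_eqI)
    let ?x' = "signed_perm (\<lambda>i. s (inv p i)) (inv p) x"
    have ss: "s i * s i = 1" for i
      using s[of i] by (metis abs_mult_self_eq mult_1)
    show "x = ?T ?x'"
      by (simp add: signed_perm_def permutes_inverses[OF p] fun_eq_iff mult.assoc[symmetric] ss)
    show "?x' \<in> vcarrier ?E"
      by (rule signed_perm_carrier[OF permutes_inv[OF p] s x])
  qed
  moreover have "?T x \<in> vcarrier ?E" if "x \<in> vcarrier ?E" for x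
    by (rule signed_perm_carrier[OF p s that])
  ultimately have surj: "?T ` vcarrier ?E = vcarrier ?E"
    by (intro equalityI subsetI) (auto simp del: linf_supp_simps)
  have "(\<lambda>i. \<bar>s i * x (p i)\<bar>) ` Field m = (\<lambda>i. \<bar>x i\<bar>) ` p ` Field m" for x
    unfolding image_image by (simp add: abs_mult s)
  then have "vnorm ?E (?T x) = vnorm ?E x" for x
    by (simp add: linf_def signed_perm_def permutes_image[OF p])
  then show ?thesis
    using surj by (simp add: isometric_automorphisms_def signed_perm_def algebra_simps)
qed

section \<open>Extending injections to permutations\<close>

lemma card_of_diff_smaller:
  assumes M: "infinite M" and P: "|P| <o |M|"
  shows "|M - P| =o |M|"
proof -
  have "\<not> |M - P| <o |M|"
  proof
    assume "|M - P| <o |M|"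
    then have "|(M - P) \<union> P| <o |M|"
      using card_of_Un_ordLess_infinite[OF M] P by blast
    moreover have "|M| \<le>o |(M - P) \<union> P|"
      by (rule card_of_mono1) auto
    ultimately show False
      using not_ordLess_ordLeq by blast
  qed
  moreover have "|M - P| \<le>o |M|"
    by (rule card_of_mono1) auto
  ultimately show ?thesis
    using ordLeq_iff_ordLess_or_ordIso by blast
qed

text \<open>Removing a smaller set from \<open>M\<close> does not change its cardinality, so the complements of the domain
  and of the range of \<open>f\<close> are in bijection.\<close>

lemma injection_extends_to_permutation:
  assumes M: "infinite M" and P: "P \<subseteq> M" "|P| <o |M|" and f: "inj_on f P" "f ` P \<subseteq> M"
  obtains q where "q permutes M" "\<And>a. a \<in> P \<Longrightarrow> q a = f a"
proof -
  have "|f ` P| <o |M|"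
    using P(2) card_of_image ordLeq_ordLess_trans by blast
  then have "|M - P| =o |M - f ` P|"
    using card_of_diff_smaller[OF M P(2)] card_of_diff_smaller[OF M, of "f ` P"]
    by (meson ordIso_symmetric ordIso_transitive)
  then obtain h where h: "bij_betw h (M - P) (M - f ` P)"
    using card_of_ordIso by blast
  define q where "q = (\<lambda>i. if i \<in> M then if i \<in> P then f i else h i else i)"
  have "bij_betw q P (f ` P)"
    using f P by (auto simp: bij_betw_def q_def inj_on_def)
  moreover have "bij_betw q (M - P) (M - f ` P)"
    using h by (rule bij_betw_cong[THEN iffD1, rotated]) (auto simp: q_def)
  ultimately have "bij_betw q (P \<union> (M - P)) (f ` P \<union> (M - f ` P))"
    by (rule bij_betw_combine) auto
  then have "bij_betw q M M"
    using P(1) f(2) by (simp add: Un_absorb1)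
  then have "q permutes M"
    by (rule bij_imp_permutes) (auto simp: q_def)
  moreover have "q a = f a" if "a \<in> P" for a
    using that P(1) by (auto simp: q_def)
  ultimately show ?thesis
    by (rule that)
qed

text \<open>Here \<open>p j\<close> is the inverse of a permutation that maps \<open>A\<close> onto \<open>B\<close> and \<open>S - A\<close> into the \<open>j\<close>-th of
  a sequence of disjoint sets outside \<open>B\<close>. The room for this sequence comes from an injection of
  \<open>S \<times> \<nat>\<close> into \<open>M - B\<close>. The inverse is the form in which a permutation acts on functions.\<close>

lemma almost_disjoint_permutations:
  fixes M :: "'i set"
  assumes M: "infinite M" and S: "A \<subseteq> S" "S \<subseteq> M" "|S \<times> (UNIV :: nat set)| <o |M|"
    and B: "B \<subseteq> M" "|A| =o |B|"
  shows "\<exists>p :: nat \<Rightarrow> 'i \<Rightarrow> 'i. (\<forall>j. p j permutes M) \<and> (\<forall>i\<in>B. \<forall>j. p j i \<in> A) \<and>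
    (\<forall>i j j'. i \<notin> B \<longrightarrow> p j i \<in> S \<longrightarrow> p j' i \<in> S \<longrightarrow> j = j')"
proof -
  have SM: "|S| <o |M|"
    using card_of_Times1[of "UNIV :: nat set" S] S(3) by (auto intro: ordLeq_ordLess_trans)
  have "|B| <o |M|"
    using SM B(2) card_of_mono1[OF S(1)]
    by (meson ordIso_ordLeq_trans ordIso_symmetric ordLeq_ordLess_trans)
  then have "|M - B| =o |M|"
    using card_of_diff_smaller[OF M] by blast
  then have "|S \<times> (UNIV :: nat set)| \<le>o |M - B|"
    using S(3) by (meson ordIso_symmetric ordLess_imp_ordLeq ordLeq_ordIso_trans)
  then obtain g where g: "inj_on g (S \<times> (UNIV :: nat set))" "g ` (S \<times> UNIV) \<subseteq> M - B"
    using card_of_ordLeq by metis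
  obtain h where h: "bij_betw h A B"
    using B(2) card_of_ordIso by blast
  define f where "f j a = (if a \<in> A then h a else g (a, j))" for j a
  have hB: "h a \<in> B" if "a \<in> A" for a using h that by (auto simp: bij_betw_def)
  have gB: "g (a, j) \<in> M - B" if "a \<in> S" for a j using g that by auto
  have "inj_on (f j) S" for j
  proof (rule inj_onI)
    fix a b assume "a \<in> S" "b \<in> S" "f j a = f j b"
    then show "a = b"
      using hB[of a] hB[of b] gB[of a j] gB[of b j] inj_onD[OF g(1), of "(a, j)" "(b, j)"] h
      by (auto simp: f_def bij_betw_def inj_on_def split: if_splits)
  qed
  moreover have "f j ` S \<subseteq> M" for j
    using hB gB B(1) by (auto simp: f_def)
  ultimately have "\<exists>q. q permutes M \<and> (\<forall>a\<in>S. q a = f j a)" for j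
    using injection_extends_to_permutation[OF M S(2) SM] by metis
  then obtain q where q: "\<And>j. q j permutes M" and qf: "\<And>j a. a \<in> S \<Longrightarrow> q j a = f j a"
    by metis
  show ?thesis
  proof (intro exI[of _ "\<lambda>j. inv (q j)"] conjI allI ballI impI)
    show "inv (q j) permutes M" for j
      by (rule permutes_inv[OF q])
    show "inv (q j) i \<in> A" if "i \<in> B" for i j
    proof -
      obtain a where "a \<in> A" "h a = i" using h \<open>i \<in> B\<close> by (auto simp: bij_betw_def)
      then have "q j a = i" using qf S(1) by (auto simp: f_def)
      then show ?thesis using \<open>a \<in> A\<close> permutes_inverses(2)[OF q] by metis
    qed
    have *: "\<exists>a\<in>S. i = g (a, j)" if "i \<notin> B" "inv (q j) i \<in> S" for i j
    proof -
      have "i = f j (inv (q j) i)"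
        using qf[OF that(2), of j] permutes_inverses(1)[OF q, of j i] by simp
      then show ?thesis
        using that hB by (metis f_def)
    qed
    show "j = j'" if i: "i \<notin> B" "inv (q j) i \<in> S" "inv (q j') i \<in> S" for i j j'
      using *[OF i(1,2)] *[OF i(1,3)] inj_onD[OF g(1)] by blast
  qed
qed

section \<open>The quotient norm\<close>

locale linf_quotient =
  fixes l :: "'l rel" and l' :: "'n rel" and m :: "'i rel"
  assumes l: "Cinfinite l" and l': "Cinfinite l'" and ll': "l \<le>o l'" and m: "Field m \<noteq> {}"
begin

abbreviation "E \<equiv> linf_supp l' m"
abbreviation "W \<equiv> vcarrier (linf_supp l m)"
abbreviation "Q \<equiv> quotient_space E W"

sublocale E: normed_space_on E
  by (rule normed_space_on_linf_supp[OF l' m])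

sublocale S: normed_space_on "linf_supp l m"
  by (rule normed_space_on_linf_supp[OF l m])

sublocale Q: normed_space_on Q
  by (rule normed_space_on_linf_quotient[OF l l' ll' m])

lemma W_subspace:
  "W \<subseteq> vcarrier E" "vzero E \<in> W"
  "\<And>x y. \<lbrakk>x \<in> W; y \<in> W\<rbrakk> \<Longrightarrow> vadd E x y \<in> W"
  "\<And>c x. x \<in> W \<Longrightarrow> vscale E c x \<in> W"
  "norm_closure E W \<subseteq> W"
  using ll' ordLeq_transitive S.zero_closed S.add_closed S.scale_closed linf_supp_closed[OF l]
  by simp_all blast

lemma Q_add:
  assumes "x \<in> vcarrier E" "y \<in> vcarrier E"
  shows "vadd Q (coset E W x) (coset E W y) = coset E W (vadd E x y)"
  by (rule E.coset_add) (fact W_subspace assms)+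

lemma Q_scale:
  assumes "x \<in> vcarrier E"
  shows "vscale Q c (coset E W x) = coset E W (vscale E c x)"
  by (rule E.coset_scale) (fact W_subspace assms)+

lemma Q_norm_le:
  assumes "x \<in> vcarrier E" "a \<in> coset E W x"
  shows "vnorm Q (coset E W x) \<le> vnorm E a"
  by (rule E.coset_norm_le) (fact W_subspace assms)+

lemma Q_norm_less:
  assumes "x \<in> vcarrier E" "vnorm Q (coset E W x) < r"
  shows "\<exists>w\<in>W. vnorm E (vadd E x w) < r"
proof -
  have "\<exists>a\<in>coset E W x. vnorm E a < r"
    by (rule E.coset_norm_less) (fact W_subspace assms)+
  then show ?thesis
    by (auto simp: coset_def)
qed

lemma mem_coset_self:
  assumes "x \<in> vcarrier E"
  shows "x \<in> coset E W x"
  by (rule E.mem_coset_self) (fact W_subspace assms)+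

lemma coset_W:
  assumes "w \<in> W"
  shows "coset E W w = W"
  by (rule E.coset_W) (fact W_subspace assms)+

lemma Q_carrierE:
  assumes "X \<in> vcarrier Q"
  obtains x where "x \<in> vcarrier E" "X = coset E W x"
  using assms by (auto simp: quotient_space_def)

text \<open>The cut-off changes \<open>x\<close> only where \<open>\<bar>x\<bar>\<close> exceeds \<open>r\<close>, so the change lies in \<open>W\<close>.\<close>

lemma coset_cutoff:
  assumes x: "x \<in> vcarrier E" and r: "|{i. r < \<bar>x i\<bar>}| \<le>o l" and "0 \<le> r"
  defines "x' \<equiv> \<lambda>i. if \<bar>x i\<bar> \<le> r then x i else 0"
  shows "x' \<in> vcarrier E" "x' \<in> coset E W x" "coset E W x' = coset E W x"
proof -
  obtain b where b: "\<And>i. i \<in> Field m \<Longrightarrow> \<bar>x i\<bar> \<le> b" and 0: "\<And>i. i \<notin> Field m \<Longrightarrow> x i = 0"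
    using x by (auto simp: linf_carrier_iff)
  define w where "w = (\<lambda>i. if \<bar>x i\<bar> \<le> r then 0 else - x i)"
  have "{i. w i \<noteq> 0} \<subseteq> {i. r < \<bar>x i\<bar>}"
    by (auto simp: w_def)
  then have "|{i. w i \<noteq> 0}| \<le>o l"
    by (rule ordLeq_transitive[OF card_of_mono1 r])
  moreover have "\<forall>i\<in>Field m. \<bar>w i\<bar> \<le> max 0 b"
    using b by (auto simp: w_def le_max_iff_disj)
  moreover have "\<forall>i. i \<notin> Field m \<longrightarrow> w i = 0"
    using 0 by (simp add: w_def)
  ultimately have w: "w \<in> W"
    unfolding linf_supp_simps mem_Collect_eq linf_carrier_iff by blast
  have xw: "x' = vadd E x w"
    by (auto simp: x'_def w_def)
  have wE: "w \<in> vcarrier E" using w W_subspace(1) by blast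
  show "x' \<in> vcarrier E"
    unfolding xw by (rule E.add_closed[OF x wE])
  show "x' \<in> coset E W x"
    unfolding xw coset_def using w by blast
  have "coset E W x' = vadd Q (coset E W x) (coset E W w)"
    unfolding xw by (rule Q_add[OF x wE, symmetric])
  also have "coset E W w = vzero Q"
    using coset_W[OF w] by (simp add: quotient_space_def)
  also have "vadd Q (coset E W x) (vzero Q) = coset E W x"
    using x by (intro Q.add_zero) (simp add: quotient_space_def)
  finally show "coset E W x' = coset E W x" .
qed

text \<open>The quotient norm is the essential supremum with respect to the ideal of sets of size at most \<open>l\<close>.
  This ideal is closed under countable unions, because \<open>l\<close> is infinite; hence the infimum that
  defines the norm is attained, by a cut-off.\<close>

lemma Q_norm_le_iff:
  assumes x: "x \<in> vcarrier E" and "0 \<le> r"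
  shows "vnorm Q (coset E W x) \<le> r \<longleftrightarrow> |{i. r < \<bar>x i\<bar>}| \<le>o l"
proof
  assume r: "|{i. r < \<bar>x i\<bar>}| \<le>o l"
  have "vnorm Q (coset E W x) \<le> vnorm E (\<lambda>i. if \<bar>x i\<bar> \<le> r then x i else 0)"
    by (rule Q_norm_le[OF x coset_cutoff(2)[OF x r \<open>0 \<le> r\<close>]])
  also have "\<dots> \<le> r"
    using \<open>0 \<le> r\<close> by (simp add: linf_norm_le[OF m])
  finally show "vnorm Q (coset E W x) \<le> r" .
next
  assume r: "vnorm Q (coset E W x) \<le> r"
  have "vnorm Q (coset E W x) < r + inverse (real (Suc n))" for n
    using r by (rule le_less_trans) simp
  then have "\<exists>w\<in>W. vnorm E (vadd E x w) < r + inverse (real (Suc n))" for n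
    using Q_norm_less[OF x] by blast
  then obtain w where w: "\<And>n. w n \<in> W" and wn: "\<And>n. vnorm E (vadd E x (w n)) < r + inverse (real (Suc n))"
    by metis
  \<comment> \<open>Where every \<open>w n\<close> vanishes, \<open>\<bar>x i\<bar> < r + 1 / (n + 1)\<close> for all \<open>n\<close>.\<close>
  have "{i. r < \<bar>x i\<bar>} \<subseteq> (\<Union>n. {i. w n i \<noteq> 0})"
  proof
    fix i assume i: "i \<in> {i. r < \<bar>x i\<bar>}"
    then have iF: "i \<in> Field m"
      using x \<open>0 \<le> r\<close> by (auto simp: linf_carrier_iff)
    obtain n where n: "inverse (real (Suc n)) < \<bar>x i\<bar> - r"
      using reals_Archimedean[of "\<bar>x i\<bar> - r"] i by auto
    have "vadd E x (w n) \<in> vcarrier (linf m)"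
      using E.add_closed[OF x, of "w n"] w W_subspace(1) by auto
    from linf_norm_ge[OF this iF] wn[of n] n have "w n i \<noteq> 0"
      by auto
    then show "i \<in> (\<Union>n. {i. w n i \<noteq> 0})" by auto
  qed
  moreover have "|\<Union>n. {i. w n i \<noteq> 0}| \<le>o l"
  proof (rule UNION_Cinfinite_bound)
    show "|UNIV :: nat set| \<le>o l"
      using l natLeq_ordLeq_cinfinite card_of_nat ordIso_ordLeq_trans by blast
  qed (use w l in auto)
  ultimately show "|{i. r < \<bar>x i\<bar>}| \<le>o l"
    by (rule ordLeq_transitive[OF card_of_mono1])
qed

lemma unit_ball_representative:
  assumes "X \<in> unit_ball Q"
  obtains x where "x \<in> vcarrier E" "X = coset E W x" "\<And>i. \<bar>x i\<bar> \<le> 1"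
proof -
  obtain x where x: "x \<in> vcarrier E" "X = coset E W x"
    using assms Q_carrierE by (auto simp: unit_ball_def)
  with assms have "|{i. 1 < \<bar>x i\<bar>}| \<le>o l"
    using Q_norm_le_iff[of x 1] by (auto simp: unit_ball_def)
  from coset_cutoff[OF x(1) this] show ?thesis
    by (intro that[of "\<lambda>i. if \<bar>x i\<bar> \<le> 1 then x i else 0"]) (use x in auto)
qed

text \<open>A mean of \<open>n + 2\<close> vectors is a convex combination, with weights \<open>(n + 1) / (n + 2)\<close> and
  \<open>1 / (n + 2)\<close>, of the mean of the first \<open>n + 1\<close> and the last one.\<close>

lemma mean_in_convex:
  assumes C: "convex_in Q C" and u: "\<And>j. j \<le> n \<Longrightarrow> u j \<in> vcarrier E" "\<And>j. j \<le> n \<Longrightarrow> coset E W (u j) \<in> C"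
  defines "a \<equiv> \<lambda>n i. (\<Sum>j\<le>n. u j i) / real (Suc n)"
  shows "a n \<in> vcarrier E \<and> coset E W (a n) \<in> C"
  using u
proof (induction n)
  case 0
  then show ?case by (simp add: a_def)
next
  case (Suc n)
  let ?c = "real (Suc n) / real (Suc (Suc n))" and ?d = "1 / real (Suc (Suc n))"
  have a: "a n \<in> vcarrier E" "coset E W (a n) \<in> C" and v: "u (Suc n) \<in> vcarrier E" "coset E W (u (Suc n)) \<in> C"
    using Suc by auto
  have eq: "a (Suc n) = vadd E (vscale E ?c (a n)) (vscale E ?d (u (Suc n)))"
    by (simp add: a_def fun_eq_iff add_divide_distrib del: of_nat_Suc)
  have "?c + ?d = 1"
    by (simp add: field_simps)
  then have "vadd Q (vscale Q ?c (coset E W (a n))) (vscale Q ?d (coset E W (u (Suc n)))) \<in> C"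
    using C a(2) v(2) unfolding convex_in_def by auto
  then show ?case
    using a v by (simp only: eq Q_scale Q_add E.add_closed E.scale_closed)
qed

lemma signed_perm_orbit:
  assumes "p permutes Field m" "\<And>i. \<bar>s i\<bar> = 1" and x: "x \<in> vcarrier E"
  shows "coset E W (signed_perm s p x) \<in> isometry_orbit Q (coset E W x)"
proof -
  have "signed_perm s p ` W = W"
    using signed_perm_isometric[OF assms(1,2), where l = l] by (simp add: isometric_automorphisms_def)
  note T = isometric_automorphism_quotient[OF signed_perm_isometric[OF assms(1,2)] W_subspace(1) this E.normed_space_on_axioms]
  show ?thesis
    unfolding isometry_orbit_def using T(1) T(2)[OF x, symmetric] by blast
qed

end

section \<open>Convex transitivity\<close>

text \<open>With \<open>c\<close> positive and \<open>n - c\<close> negative signs the mean is \<open>2 c / n - 1\<close>, and these numbers for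
  \<open>0 \<le> c \<le> n\<close> divide \<open>[-1, 1]\<close> in steps of \<open>2 / n\<close>.\<close>

lemma signs_with_prescribed_mean:
  fixes t :: real
  assumes "\<bar>t\<bar> \<le> 1" "0 < n"
  obtains s :: "nat \<Rightarrow> real" where "\<And>j. \<bar>s j\<bar> = 1" "\<bar>(\<Sum>j<n. s j) / n - t\<bar> \<le> 2 / n"
proof -
  let ?r = "real n * (1 + t) / 2"
  define c where "c = nat \<lfloor>?r\<rfloor>"
  define s where "s j = (if j < c then 1 else -1 :: real)" for j
  have "0 \<le> ?r" using assms by auto
  then have c: "real c \<le> ?r" "?r < real c + 1"
    unfolding c_def by linarith+
  have "?r \<le> real n * (1 + 1) / 2"
    using assms by (intro divide_right_mono mult_left_mono) auto
  then have "?r \<le> real n" by simp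
  then have "c \<le> n" using c(1) by (metis of_nat_le_iff order_trans)
  have "(\<Sum>j<n. s j) = (\<Sum>j\<in>{..<c}. s j) + (\<Sum>j\<in>{c..<n}. s j)"
    using \<open>c \<le> n\<close> by (metis atLeast0LessThan le0 sum.atLeastLessThan_concat)
  also have "\<dots> = 2 * real c - n"
    using \<open>c \<le> n\<close> by (simp add: s_def of_nat_diff)
  finally have "(\<Sum>j<n. s j) / n - t = (2 * real c - n * (1 + t)) / n"
    using assms(2) by (simp add: field_simps)
  moreover have "\<bar>2 * real c - n * (1 + t)\<bar> \<le> 2"
    using c by (simp add: abs_le_iff)
  ultimately have "\<bar>(\<Sum>j<n. s j) / n - t\<bar> \<le> 2 / n"
    by (simp add: divide_right_mono)
  moreover have "\<bar>s j\<bar> = 1" for j by (simp add: s_def)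
  ultimately show ?thesis using that by blast
qed

lemma sum_at_most_one_nonzero:
  fixes f :: "'a \<Rightarrow> real"
  assumes "\<And>j. j \<in> J \<Longrightarrow> \<bar>f j\<bar> \<le> 1" "\<And>j j'. f j \<noteq> 0 \<Longrightarrow> f j' \<noteq> 0 \<Longrightarrow> j = j'"
  shows "\<bar>\<Sum>j\<in>J. f j\<bar> \<le> 1"
proof (cases "finite J \<and> (\<exists>j\<in>J. f j \<noteq> 0)")
  case True
  then obtain j where "finite J" and j: "j \<in> J" "f j \<noteq> 0" by blast
  then have "(\<Sum>j\<in>J. f j) = f j + (\<Sum>j'\<in>J - {j}. f j')"
    by (simp add: sum.remove)
  also have "(\<Sum>j'\<in>J - {j}. f j') = 0"
    using assms(2) j by (intro sum.neutral) blast
  finally show ?thesis using assms(1) j by simp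
next
  case False
  then have "(\<Sum>j\<in>J. f j) = 0"
    by (cases "finite J") (auto intro: sum.neutral)
  then show ?thesis by simp
qed

theorem convex_transitive_cardSuc_quotient:
  fixes k :: "'k rel" and m :: "'i rel"
  assumes k: "Cinfinite k" and m: "Card_order m" and km: "cardSuc k <o m"
  shows "convex_transitive (quotient_space (linf_supp (cardSuc k) m) (vcarrier (linf_supp k m)))"
proof -
  have k': "Cinfinite (cardSuc k)"
    using k by (rule Cinfinite_cardSuc)
  have mF: "|Field m| =o m"
    using m by (rule card_of_Field_ordIso)
  have "Cinfinite m"
    using k' m km ordLess_imp_ordLeq cinfinite_mono by blast
  then have M: "infinite (Field m)"
    by (simp add: cinfinite_def)
  interpret linf_quotient k "cardSuc k" m
    by unfold_locales (use k k' M cardSuc_ordLeq in auto)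
  have "Y \<in> norm_closure Q (convex_in Q hull isometry_orbit Q X)"
    if X: "X \<in> unit_sphere Q" and Y: "Y \<in> unit_ball Q" for X Y
    unfolding norm_closure_def
  proof (intro CollectI conjI allI impI)
    show "Y \<in> vcarrier Q" using Y by (simp add: unit_ball_def)
    fix e :: real assume "e > 0"
    \<comment> \<open>\<open>d < 1\<close> keeps \<open>1 - d\<close> positive, so that \<open>A\<close> below lies in the support of \<open>x\<close>.\<close>
    define d where "d = min (e/2) (1/2)"
    have d: "0 < d" "d < 1" "d \<le> e/2" using \<open>e > 0\<close> by (auto simp: d_def)
    obtain n where n: "4 / e < real (Suc n)"
      using reals_Archimedean2[of "4 / e"] by (metis less_SucI less_trans lessI of_nat_less_iff)
    let ?N = "Suc n"
    have "X \<in> unit_ball Q" using X by (simp add: unit_ball_def unit_sphere_def)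
    then obtain x where x: "x \<in> vcarrier E" "X = coset E W x" "\<And>i. \<bar>x i\<bar> \<le> 1"
      using unit_ball_representative by blast
    obtain y where y: "y \<in> vcarrier E" "Y = coset E W y" "\<And>i. \<bar>y i\<bar> \<le> 1"
      using Y unit_ball_representative by blast
    define S where "S = {i. x i \<noteq> 0}"
    define A where "A = {i. 1 - d < \<bar>x i\<bar>}"
    \<comment> \<open>Adding \<open>A\<close> brings \<open>B\<close> to the cardinality of \<open>A\<close> even if the support of \<open>y\<close> is small.\<close>
    define B where "B = A \<union> {i. y i \<noteq> 0}"
    have AS: "A \<subseteq> S" using d by (auto simp: A_def S_def)
    have S: "S \<subseteq> Field m" "|S| \<le>o cardSuc k"
      using x(1) by (auto simp: S_def linf_carrier_iff)
    have y_supp: "{i. y i \<noteq> 0} \<subseteq> Field m" "|{i. y i \<noteq> 0}| \<le>o cardSuc k"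
      using y(1) by (auto simp: linf_carrier_iff)
    have "\<not> vnorm Q (coset E W x) \<le> 1 - d"
      using X d x(2) by (simp add: unit_sphere_def)
    then have "\<not> |A| \<le>o k"
      using Q_norm_le_iff[OF x(1), of "1 - d"] d by (simp add: A_def)
    then have "k <o |A|"
      using k card_of_Well_order not_ordLeq_iff_ordLess by (metis card_order_on_well_order_on)
    then have Ak: "cardSuc k \<le>o |A|"
      using k cardSuc_least card_of_Card_order by blast
    have "|A| \<le>o cardSuc k"
      using AS S(2) card_of_mono1 ordLeq_transitive by blast
    then have "|B| \<le>o cardSuc k"
      unfolding B_def using y_supp k' by (intro Un_Cinfinite_bound) auto
    then have "|B| \<le>o |A|" using Ak ordLeq_transitive by blast
    moreover have "|A| \<le>o |B|" by (simp add: B_def card_of_mono1)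
    ultimately have AB: "|A| =o |B|" by (simp add: ordIso_iff_ordLeq)
    have "|S \<times> (UNIV :: nat set)| \<le>o cardSuc k"
    proof -
      have "|UNIV :: nat set| \<le>o cardSuc k"
        using k' natLeq_ordLeq_cinfinite card_of_nat ordIso_ordLeq_trans by blast
      then show ?thesis
        using S(2) k' by (intro card_of_Times_ordLeq_infinite_Field) (auto simp: cinfinite_def)
    qed
    then have SN: "|S \<times> (UNIV :: nat set)| <o |Field m|"
      using km mF ordIso_symmetric ordLeq_ordLess_trans ordLess_ordIso_trans by blast
    have BF: "B \<subseteq> Field m" using AS S y_supp by (auto simp: B_def)
    obtain p :: "nat \<Rightarrow> 'i \<Rightarrow> 'i" where
      p: "\<And>j. p j permutes Field m" and pA: "\<And>i j. i \<in> B \<Longrightarrow> p j i \<in> A"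
      and pS: "\<And>i j j'. i \<notin> B \<Longrightarrow> p j i \<in> S \<Longrightarrow> p j' i \<in> S \<Longrightarrow> j = j'"
      using almost_disjoint_permutations[OF M AS S(1) SN BF AB] by metis
    have "\<exists>s. (\<forall>j. \<bar>s j\<bar> = 1) \<and> \<bar>(\<Sum>j<?N. s j) / ?N - y i\<bar> \<le> 2 / ?N" for i
      using signs_with_prescribed_mean[OF y(3)] by (metis zero_less_Suc)
    then obtain s where s: "\<And>i j. \<bar>s i j\<bar> = 1"
      and s_mean: "\<And>i. \<bar>(\<Sum>j<?N. s i j) / ?N - y i\<bar> \<le> 2 / ?N"
      by metis
    \<comment> \<open>The inner sign turns the values of \<open>x\<close> into absolute values, the outer one approximates \<open>y\<close>.\<close>
    define u where "u j = signed_perm (\<lambda>i. s i j * (if x (p j i) < 0 then -1 else 1)) (p j) x" for j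
    have u: "u j i = s i j * \<bar>x (p j i)\<bar>" for i j
      by (simp add: u_def signed_perm_def)
    have sgn: "\<bar>s i j * (if x (p j i) < 0 then -1 else 1)\<bar> = 1" for i j
      by (simp add: abs_mult s)
    have uE: "u j \<in> vcarrier E" and u_orbit: "coset E W (u j) \<in> isometry_orbit Q X" for j
      unfolding u_def x(2)
      by (rule signed_perm_carrier[OF p sgn x(1)], rule signed_perm_orbit[OF p sgn x(1)])
    define z where "z = (\<lambda>i. (\<Sum>j\<le>n. u j i) / real ?N)"
    let ?C = "convex_in Q hull isometry_orbit Q X"
    have "z \<in> vcarrier E \<and> coset E W z \<in> C" if "convex_in Q C" "isometry_orbit Q X \<subseteq> C" for C
      unfolding z_def using that u_orbit by (intro mean_in_convex uE) auto
    then have zC: "coset E W z \<in> ?C"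
      unfolding hull_def by blast
    have "convex_in Q (vcarrier Q)"
      by (simp add: convex_in_def Q.add_closed Q.scale_closed del: linf_supp_simps)
    moreover have "coset E W (u j) \<in> vcarrier Q" for j
      using uE by (simp add: quotient_space_def)
    ultimately have zE: "z \<in> vcarrier E"
      unfolding z_def using mean_in_convex[of "vcarrier Q" n u] uE by blast
    have dist: "\<bar>y i - z i\<bar> \<le> d + 2 / ?N" for i
    proof (cases "i \<in> B")
      case True
      have "\<bar>u j i - s i j\<bar> \<le> d" for j
      proof -
        have "u j i - s i j = s i j * (\<bar>x (p j i)\<bar> - 1)"
          by (simp add: u algebra_simps)
        then show ?thesis
          using pA[OF True, of j] x(3)[of "p j i"] by (simp add: abs_mult s A_def)
      qed
      then have "(\<Sum>j\<le>n. \<bar>u j i - s i j\<bar>) \<le> real (card {..n}) * d"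
        by (intro sum_bounded_above) auto
      then have "\<bar>(\<Sum>j\<le>n. u j i) - (\<Sum>j\<le>n. s i j)\<bar> \<le> real ?N * d"
        using sum_abs[of "\<lambda>j. u j i - s i j" "{..n}"] by (simp add: sum_subtractf)
      then have "\<bar>z i - (\<Sum>j\<le>n. s i j) / ?N\<bar> \<le> d"
        unfolding z_def by (simp add: diff_divide_distrib[symmetric] divide_le_eq mult.commute del: of_nat_Suc)
      then show ?thesis
        using s_mean[of i] by (simp only: lessThan_Suc_atMost)
    next
      case False
      then have "y i = 0" by (simp add: B_def)
      have "\<bar>\<Sum>j\<le>n. u j i\<bar> \<le> 1"
        using x(3) pS[OF False] by (intro sum_at_most_one_nonzero) (auto simp: u abs_mult s S_def)
      then have "\<bar>z i\<bar> \<le> 1 / ?N"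
        by (simp add: z_def divide_right_mono del: of_nat_Suc)
      also have "\<dots> \<le> d + 2 / ?N"
        using d by (intro add_increasing divide_right_mono) auto
      finally show ?thesis using \<open>y i = 0\<close> by simp
    qed
    have yz: "vadd E y (vscale E (-1) z) \<in> vcarrier E"
      using y(1) zE by (intro E.add_closed E.scale_closed)
    have "vdist Q Y (coset E W z) = vnorm Q (coset E W (vadd E y (vscale E (-1) z)))"
      unfolding vdist_def y(2) using y(1) zE by (simp only: Q_scale Q_add E.scale_closed)
    also have "\<dots> \<le> vnorm E (vadd E y (vscale E (-1) z))"
      by (rule Q_norm_le[OF yz mem_coset_self[OF yz]])
    also have "\<dots> \<le> d + 2 / ?N"
      using dist M by (auto simp del: of_nat_Suc intro!: linf_norm_le)
    also have "\<dots> < e"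
    proof -
      have "4 < e * real ?N" using n \<open>e > 0\<close> by (simp add: field_simps)
      then have "2 / real ?N < e / 2" by (simp add: field_simps)
      then show ?thesis using d by linarith
    qed
    finally show "\<exists>Z\<in>?C. vdist Q Y Z < e" using zC by blast
  qed
  then show ?thesis
    using Q.closed_hull_orbit_subset unfolding convex_transitive_def by blast
qed

theorem theorem3p5:
  fixes k :: "'k rel"
  assumes "Cinfinite k"
  shows "convex_transitive
    (quotient_space
      (linf_supp (cardSuc k) (cardSuc (cardSuc k)))
      (vcarrier (linf_supp k (cardSuc (cardSuc k)))))"
proof (rule convex_transitive_cardSuc_quotient[OF assms])
  have "Card_order (cardSuc k)"
    using assms by (simp add: cardSuc_Card_order)
  then show "Card_order (cardSuc (cardSuc k))" "cardSuc k <o cardSuc (cardSuc k)"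
    by (rule cardSuc_Card_order, rule cardSuc_greater)
qed

end
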